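(* Let $A\in\mathbb{R}^{m\times n}$ with $m\ge n$, with rows $a_1^T,\dots,a_m^T$, let $b=(b_1,\dots,b_m)^T\in\mathbb{R}^m$, and suppose the linear system $Ax=b$ is consistent. Assume that every row of $A$ is nonzero and that, with the cyclic convention $a_{m+1}:=a_1$, the vectors $a_i$ and $a_{i+1}$ are linearly independent for every $i=1,\dots,m$. Let $x^{(0)}\in\mathbb{R}^n$ be arbitrary, let $\tilde{x}$ be a solution of $Ax=b$ such that $P_{N(A)}(\tilde{x})=P_{N(A)}(x^{(0)})$, and let $\{x^{(k)}\}_{k\ge 1}$ be the sequence generated from $x^{(0)}$ by the (cyclic) Kaczmarz method with oblique projection (KO) defined in the context. Then $$\lim_{k\to\infty}x^{(k)}=\tilde{x}.$$ If, in addition, $x^{(0)}\in R(A^T)$, then $\{x^{(k)}\}$ converges to the least-norm solution of $Ax=b$, i.e. $\lim_{k\to\infty}x^{(k)}=x^*$, where $x^*=A^{\dagger}b$.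
   Context: Notation: $\langle\cdot,\cdot\rangle$ and $\|\cdot\|$ are the Euclidean inner product and norm; $N(A)$ is the null space of $A$, $R(A^T)$ the range of $A^T$, $P_{N(A)}$ the orthogonal projection onto $N(A)$, and $A^{\dagger}$ the Moore-Penrose inverse of $A$. KO method (cyclic Kaczmarz method with oblique projection). Put $i_k=((k-1)\bmod m)+1$ for $k\ge 1$, so that $i_1=1$ and the indices run cyclically through $1,\dots,m$. Given $x^{(0)}\in\mathbb{R}^n$, set $$x^{(1)}=x^{(0)}+\frac{b_1-\langle a_1,x^{(0)}\rangle}{\|a_1\|^2}a_1,$$ and for $k\ge 1$ set $$w^{(i_k)}=a_{i_{k+1}}-\frac{\langle a_{i_k},a_{i_{k+1}}\rangle}{\|a_{i_k}\|^2}a_{i_k},\qquad x^{(k+1)}=x^{(k)}+\frac{b_{i_{k+1}}-\langle a_{i_{k+1}},x^{(k)}\rangle}{\|w^{(i_k)}\|^2}\,w^{(i_k)}.$$ The linear independence of cyclically consecutive rows guarantees $w^{(i_k)}\neq 0$. *)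

theory Defs
  imports "HOL-Analysis.Analysis"
begin

definition null_space :: "real^'n^'m \<Rightarrow> (real^'n) set" where
  "null_space A = {x. A *v x = 0}"

definition orth_proj :: "'a::euclidean_space set \<Rightarrow> 'a \<Rightarrow> 'a" where
  "orth_proj S x = (THE p. p \<in> S \<and> (\<forall>v\<in>S. inner (x - p) v = 0))"

lemma orth_proj_ex1:
  fixes S :: "'a::euclidean_space set"
  assumes "subspace S"
  shows "\<exists>!p. p \<in> S \<and> (\<forall>v\<in>S. inner (x - p) v = 0)"
proof -
  obtain y z where y: "y \<in> span S" and z: "\<And>w. w \<in> span S \<Longrightarrow> orthogonal z w"
    and x: "x = y + z"
    using orthogonal_subspace_decomp_exists by blast
  have sp: "span S = S"
    using assms by (simp add: span_eq_iff)
  show ?thesis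
  proof (rule ex1I[of _ y])
    show "y \<in> S \<and> (\<forall>v\<in>S. inner (x - y) v = 0)"
      using y z x sp by (auto simp: orthogonal_def)
  next
    fix p assume p: "p \<in> S \<and> (\<forall>v\<in>S. inner (x - p) v = 0)"
    have d: "p - y \<in> S"
      using p y sp assms by (simp add: subspace_diff)
    have "inner (x - p) (p - y) = 0" "inner (x - y) (p - y) = 0"
      using p d z x sp by (auto simp: orthogonal_def)
    then have "inner (p - y) (p - y) = 0"
      by (simp add: inner_diff_left)
    then show "p = y" by simp
  qed
qed

definition is_moore_penrose :: "real^'n^'m \<Rightarrow> real^'m^'n \<Rightarrow> bool" where
  "is_moore_penrose A X \<longleftrightarrow>
     A ** X ** A = A \<and> X ** A ** X = X \<and>
     transpose (A ** X) = A ** X \<and> transpose (X ** A) = X ** A"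

definition moore_penrose :: "real^'n^'m \<Rightarrow> real^'m^'n" where
  "moore_penrose A = (THE X. is_moore_penrose A X)"

lemma normal_equations_solvable:
  fixes A :: "real^'n^'m"
  shows "\<exists>Y :: real^'m^'n. transpose A ** A ** Y = transpose A"
proof -
  have "\<exists>u. transpose A *v (A *v u) = transpose A *v y" for y :: "real^'m"
  proof -
    obtain p z where p: "p \<in> span (range ((*v) A))"
      and z: "\<And>w. w \<in> span (range ((*v) A)) \<Longrightarrow> orthogonal z w" and y: "y = p + z"
      using orthogonal_subspace_decomp_exists by blast
    have "span (range ((*v) A)) = range ((*v) A)"
      by (metis matrix_vector_mul_linear span_UNIV linear_span_image)
    then obtain u where u: "p = A *v u" using p by (metis imageE)
    have "inner (transpose A *v z) w = 0" for w
      using z[of "A *v w"]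
      by (simp add: dot_lmul_matrix orthogonal_def span_base)
    then have "transpose A *v z = 0"
      using inner_eq_zero_iff by blast
    then show ?thesis
      using u y by (metis add.right_neutral matrix_vector_right_distrib)
  qed
  then obtain g where g: "\<And>y. transpose A *v (A *v g y) = transpose A *v y"
    by metis
  define Y :: "real^'m^'n" where "Y = (\<chi> i j. g (axis j 1) $ i)"
  have "column j (transpose A ** A ** Y) = column j (transpose A)" for j
  proof -
    have "Y *v axis j 1 = g (axis j 1)"
      by (simp add: matrix_vector_mult_basis column_def Y_def)
    then show ?thesis
      by (metis g matrix_vector_mult_basis matrix_vector_mul_assoc)
  qed
  then have "transpose A ** A ** Y = transpose A"
    by (auto simp: column_def vec_eq_iff)
  then show ?thesis ..
qed

lemma moore_penrose_ex1: "\<exists>!X. is_moore_penrose A X"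
  for A :: "real^'n^'m"
proof -
  have one: "\<exists>Y. B ** Y ** B = B \<and> transpose (B ** Y) = B ** Y" for B :: "real^'p^'q"
  proof -
    obtain Y :: "real^'q^'p" where Y: "transpose B ** B ** Y = transpose B"
      using normal_equations_solvable by blast
    have "transpose (B ** Y) ** (B ** Y) = transpose (B ** Y)"
      by (metis Y matrix_mul_assoc matrix_transpose_mul)
    then have s: "transpose (B ** Y) = B ** Y"
      by (metis matrix_transpose_mul transpose_transpose)
    have "B ** Y ** B = B"
      by (metis Y s matrix_mul_assoc matrix_transpose_mul transpose_transpose)
    then show ?thesis using s by blast
  qed
  obtain Y where Y: "A ** Y ** A = A" "transpose (A ** Y) = A ** Y"
    using one[of A] by blast
  obtain Z where Z: "transpose A ** Z ** transpose A = transpose A"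
      "transpose (transpose A ** Z) = transpose A ** Z"
    using one[of "transpose A"] by blast
  define W where "W = transpose Z"
  have W: "A ** W ** A = A" "transpose (W ** A) = W ** A"
    using Z by (metis W_def matrix_mul_assoc matrix_transpose_mul transpose_transpose)+
  define X where "X = W ** A ** Y"
  have AX: "A ** X = A ** Y" and XA: "X ** A = W ** A"
    using W Y by (metis X_def matrix_mul_assoc)+
  have "X ** A ** X = X"
    by (metis AX XA X_def W(1) matrix_mul_assoc)
  then have ex: "is_moore_penrose A X"
    using AX XA W Y by (simp add: is_moore_penrose_def)
  have "U = V" if U: "is_moore_penrose A U" and V: "is_moore_penrose A V" for U V
  proof -
    have "A ** U = A ** V"
      using U V unfolding is_moore_penrose_def
      by (metis matrix_mul_assoc matrix_transpose_mul)
    moreover have "U ** A = V ** A"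
      using U V unfolding is_moore_penrose_def
      by (metis matrix_mul_assoc matrix_transpose_mul)
    ultimately show ?thesis
      using U V unfolding is_moore_penrose_def by (metis matrix_mul_assoc)
  qed
  then show ?thesis using ex by blast
qed

text \<open>Strictness for the other solutions expresses that \<open>x\<close> is \<^emph>\<open>the\<close> least-norm solution.\<close>

definition is_least_norm_solution :: "real^'n^'m \<Rightarrow> real^'m \<Rightarrow> real^'n \<Rightarrow> bool" where
  "is_least_norm_solution A b x \<longleftrightarrow>
     A *v x = b \<and> (\<forall>y. A *v y = b \<and> y \<noteq> x \<longrightarrow> norm x < norm y)"

definition cyc :: "nat \<Rightarrow> nat \<Rightarrow> nat" where
  "cyc m k = (k - 1) mod m + 1"

text \<open>
  The row index type \<open>'m\<close> carries no order, so the order in which the rows are swept is given by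
  an enumeration \<open>e\<close>, intended to be a bijection from \<open>{1..CARD('m)}\<close> onto \<open>'m\<close>: the \<open>i\<close>-th row
  of \<open>A\<close> is \<open>row (e i) A\<close> and the \<open>i\<close>-th entry of \<open>b\<close> is \<open>b $ e i\<close>.
  The argument \<open>k\<close> of \<open>ko_dir\<close> is the iteration counter, not the cyclic index \<open>i\<^sub>k = cyc m k\<close>.
\<close>

definition ko_dir :: "real^'n^'m \<Rightarrow> (nat \<Rightarrow> 'm) \<Rightarrow> nat \<Rightarrow> real^'n" where
  "ko_dir A e k =
     (let a = row (e (cyc CARD('m) k)) A; a' = row (e (cyc CARD('m) (k + 1))) A
      in a' - (inner a a' / (norm a)\<^sup>2) *\<^sub>R a)"

fun ko_seq :: "real^'n^'m \<Rightarrow> real^'m \<Rightarrow> (nat \<Rightarrow> 'm) \<Rightarrow> real^'n \<Rightarrow> nat \<Rightarrow> real^'n" where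
  "ko_seq A b e x0 0 = x0"
| "ko_seq A b e x0 (Suc 0) =
     x0 + ((b $ e 1 - inner (row (e 1) A) x0) / (norm (row (e 1) A))\<^sup>2) *\<^sub>R row (e 1) A"
| "ko_seq A b e x0 (Suc (Suc j)) =
     (let k = Suc j; x = ko_seq A b e x0 k; i' = e (cyc CARD('m) (k + 1)); w = ko_dir A e k
      in x + ((b $ i' - inner (row i' A) x) / (norm w)\<^sup>2) *\<^sub>R w)"

end

theory Submission
  imports Defs
begin

text \<open>
  Put \<open>y\<^sub>k = x\<^sub>k - x\<close> for the solution \<open>x\<close>. After the first step \<open>y\<^sub>k\<close> is orthogonal to the row
  \<open>a\<close> used last, so in the next step the row \<open>a'\<close> may be replaced by its component \<open>w\<close> orthogonal to
  \<open>a\<close>: the step is the orthogonal projection of \<open>y\<^sub>k\<close> onto the complement of \<open>w\<close>. Hence the squared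
  norms of the increments telescope and the increments tend to \<open>0\<close>. Every row is orthogonal to some
  \<open>y\<^sub>k\<close> in each window of length \<open>m\<close>, so \<open>A y\<^sub>k\<close> tends to \<open>0\<close>. All \<open>y\<^sub>k\<close> lie in the orthogonal
  complement of the null space, where \<open>A\<close> is bounded below, and so \<open>y\<^sub>k\<close> tends to \<open>0\<close>.
\<close>

text \<open>Pythagoras: \<open>z\<close> is \<open>y\<close> without its component along
  \<open>w\<close>, so \<open>z\<close> is orthogonal to \<open>z - y\<close>. For
  \<open>w = 0\<close> division by zero gives \<open>z = y\<close>.\<close>

lemma norm_projection_step:
  fixes y w :: "'a::real_inner"
  defines "z \<equiv> y - (inner w y / (norm w)\<^sup>2) *\<^sub>R w"
  shows "(norm (z - y))\<^sup>2 = (norm y)\<^sup>2 - (norm z)\<^sup>2"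
proof (cases "w = 0")
  case False
  then show ?thesis
    unfolding z_def power2_norm_eq_inner
    by (simp add: inner_diff_left inner_diff_right inner_commute field_simps)
qed (simp add: z_def)

lemma increments_tendsto_0:
  fixes y :: "nat \<Rightarrow> 'a::real_normed_vector"
  assumes "\<And>k. (norm (y (Suc k) - y k))\<^sup>2 = (norm (y k))\<^sup>2 - (norm (y (Suc k)))\<^sup>2"
  shows "(\<lambda>k. y (Suc k) - y k) \<longlonglongrightarrow> 0"
proof -
  define f where "f k = (norm (y k))\<^sup>2" for k
  have step: "(norm (y (Suc k) - y k))\<^sup>2 = f k - f (Suc k)" for k
    using assms by (simp add: f_def)
  have "decseq f"
    using step by (intro decseq_SucI) (metis diff_ge_0_iff_ge zero_le_power2)
  moreover have "\<And>k. 0 \<le> f k" by (simp add: f_def)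
  ultimately obtain l where l: "f \<longlonglongrightarrow> l"
    using decseq_convergent by blast
  have "(\<lambda>k. f k - f (Suc k)) \<longlonglongrightarrow> l - l"
    by (intro tendsto_diff l LIMSEQ_Suc)
  then have "(\<lambda>k. sqrt ((norm (y (Suc k) - y k))\<^sup>2)) \<longlonglongrightarrow> sqrt 0"
    by (intro tendsto_real_sqrt) (simp add: step)
  then show ?thesis
    by (simp add: tendsto_norm_zero_iff)
qed

text \<open>A zero lies fewer than \<open>m\<close> steps ahead of every \<open>k\<close>, so by
  Cauchy-Schwarz \<open>inner a (y k)\<close> is at most \<open>norm a\<close> times the sum of the
  next \<open>m\<close> increment norms. Since \<open>m\<close> is fixed, that sum tends to
  0.\<close>

lemma inner_tendsto_0_if_recurrently_0:
  fixes y :: "nat \<Rightarrow> 'a::real_inner"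
  assumes incr: "(\<lambda>k. y (Suc k) - y k) \<longlonglongrightarrow> 0"
    and rec: "\<And>k. \<exists>j<m. inner a (y (k + j)) = 0"
  shows "(\<lambda>k. inner a (y k)) \<longlonglongrightarrow> 0"
proof -
  define d where "d k = norm (y (Suc k) - y k)" for k
  have "(\<lambda>k. d (k + i)) \<longlonglongrightarrow> 0" for i
    using incr unfolding d_def by (intro LIMSEQ_ignore_initial_segment tendsto_norm_zero)
  then have "(\<lambda>k. norm a * (\<Sum>i<m. d (k + i))) \<longlonglongrightarrow> norm a * (\<Sum>i<m. 0)"
    by (intro tendsto_mult tendsto_const tendsto_sum)
  then have lim: "(\<lambda>k. norm a * (\<Sum>i<m. d (k + i))) \<longlonglongrightarrow> 0"
    by simp
  have "norm (inner a (y k)) \<le> norm a * (\<Sum>i<m. d (k + i))" for k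
  proof -
    obtain j where j: "j < m" "inner a (y (k + j)) = 0"
      using rec by blast
    have "y (k + j) - y k = (\<Sum>i<j. y (Suc (k + i)) - y (k + i))"
      using sum_lessThan_telescope[of "\<lambda>i. y (k + i)" j] by simp
    then have "norm (y (k + j) - y k) \<le> (\<Sum>i<j. d (k + i))"
      by (simp add: d_def sum_norm_le)
    also have "\<dots> \<le> (\<Sum>i<m. d (k + i))"
      using j(1) by (intro sum_mono2) (auto simp: d_def)
    finally have "norm (y (k + j) - y k) \<le> (\<Sum>i<m. d (k + i))" .
    moreover have "norm (inner a (y k)) = norm (inner a (y (k + j) - y k))"
      using j(2) by (simp add: inner_diff_right)
    ultimately show ?thesis
      by (metis Cauchy_Schwarz_ineq2 mult_left_mono norm_ge_zero order_trans real_norm_def)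
  qed
  then show ?thesis
    by (intro Lim_null_comparison[OF _ lim]) simp
qed

text \<open>In finite dimension a linear map that is injective on a subspace is bounded below there
  by a positive multiple of the norm.\<close>

lemma tendsto_0_if_linear_image:
  fixes f :: "'a::euclidean_space \<Rightarrow> 'b::euclidean_space"
  assumes f: "linear f" and S: "subspace S" and inj: "\<And>x. x \<in> S \<Longrightarrow> f x = 0 \<Longrightarrow> x = 0"
    and y: "\<And>k. y k \<in> S" and lim: "(\<lambda>k. f (y k)) \<longlonglongrightarrow> 0"
  shows "y \<longlonglongrightarrow> 0"
proof -
  obtain c where c: "c > 0" "\<And>x. x \<in> S \<Longrightarrow> c * norm x \<le> norm (f x)"
    using injective_imp_isometric[OF closed_subspace[OF S] S linear_linear[THEN iffD2, OF f]] inj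
    by metis
  have le: "norm (y k) \<le> norm (f (y k)) / c" for k
    using c(2)[OF y] c(1) by (simp add: pos_le_divide_eq mult.commute)
  have "(\<lambda>k. norm (f (y k)) / c) \<longlonglongrightarrow> 0"
    using tendsto_norm_zero[OF lim] by (rule tendsto_divide_zero)
  then show ?thesis
    by (rule Lim_null_comparison[OF always_eventually[OF allI[OF le]]])
qed

lemma subspace_null_space: "subspace (null_space A)"
  by (simp add: null_space_def subspace_def matrix_vector_right_distrib matrix_vector_mult_scaleR)

lemma matrix_vector_mult_nth: "(A *v x) $ i = inner (row i A) x"
  for A :: "real^'n^'m"
  by (simp add: matrix_vector_mul_component row_def)

lemma orth_proj:
  assumes "subspace S"
  shows "orth_proj S x \<in> S" and "v \<in> S \<Longrightarrow> inner (x - orth_proj S x) v = 0"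
  using theI'[OF orth_proj_ex1[OF assms, of x]] by (auto simp: orth_proj_def)

lemma orthogonal_diff_if_orth_proj_eq:
  assumes "subspace S" "orth_proj S x = orth_proj S y" "v \<in> S"
  shows "inner (x - y) v = 0"
  using orth_proj(2)[OF assms(1,3), of x] orth_proj(2)[OF assms(1,3), of y] assms(2)
  by (simp add: inner_diff_left)

lemma range_transpose_orthogonal_null_space:
  fixes A :: "real^'n^'m"
  assumes "x \<in> range ((*v) (transpose A))" "v \<in> null_space A"
  shows "inner x v = 0"
  using assms by (auto simp: null_space_def dot_lmul_matrix)

lemma moore_penrose: "is_moore_penrose A (moore_penrose A)"
  unfolding moore_penrose_def by (rule theI'[OF moore_penrose_ex1])

lemma moore_penrose_solution:
  assumes "A *v x = b"
  shows "A *v (moore_penrose A *v b) = b"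
    and "moore_penrose A *v b \<in> range ((*v) (transpose A))"
proof -
  let ?X = "moore_penrose A"
  show "A *v (?X *v b) = b"
    using moore_penrose[of A] assms
    by (metis is_moore_penrose_def matrix_vector_mul_assoc)
  \<comment> \<open>Symmetry of \<open>?X ** A\<close> allows the transpose, which moves
    \<open>transpose A\<close> to the outside.\<close>
  have "?X *v b = transpose (?X ** A) *v x"
    using moore_penrose[of A] assms
    by (metis is_moore_penrose_def matrix_vector_mul_assoc)
  then show "?X *v b \<in> range ((*v) (transpose A))"
    by (simp add: matrix_transpose_mul flip: matrix_vector_mul_assoc)
qed

text \<open>Any other solution differs from \<open>x\<close> by a nonzero null vector, which is
  orthogonal to \<open>x\<close>; Pythagoras then gives strictness.\<close>

lemma is_least_norm_solutionI:
  assumes x: "A *v x = b" and orth: "\<And>v. v \<in> null_space A \<Longrightarrow> inner x v = 0"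
  shows "is_least_norm_solution A b x"
  unfolding is_least_norm_solution_def
proof (intro conjI allI impI x)
  fix y assume y: "A *v y = b \<and> y \<noteq> x"
  then have "inner x (y - x) = 0"
    using x by (intro orth) (simp add: null_space_def matrix_vector_mult_diff_distrib)
  then have "(norm y)\<^sup>2 = (norm x)\<^sup>2 + (norm (y - x))\<^sup>2"
    unfolding power2_norm_eq_inner by (simp add: inner_diff inner_commute)
  then show "norm x < norm y"
    using y by (intro power2_less_imp_less[of "norm x"]) simp_all
qed

text \<open>Matches the wrap-around in the independence hypothesis. The recursion starts at
  \<open>Suc k\<close> because truncated subtraction makes \<open>cyc m 0\<close> equal to
  \<open>cyc m 1\<close>.\<close>

lemma cyc_Suc:
  assumes "0 < m"
  shows "cyc m (Suc (Suc k)) = (if cyc m (Suc k) = m then 1 else cyc m (Suc k) + 1)"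
  using assms by (auto simp: cyc_def mod_Suc)

lemma cyc_in: "0 < m \<Longrightarrow> cyc m k \<in> {1..m}"
  by (simp add: cyc_def Suc_leI)

lemma cyc_recurrent:
  assumes "i \<in> {1..m}"
  shows "\<exists>j<m. cyc m (Suc (k + j)) = i"
proof -
  have m: "0 < m" "i - 1 < m" using assms by auto
  \<comment> \<open>The residue of \<open>i - 1 - k\<close>, written so that no natural subtraction
    truncates.\<close>
  define j where "j = (i - 1 + (m - k mod m)) mod m"
  have "(k + j) mod m = (k mod m + (i - 1 + (m - k mod m))) mod m"
    by (simp add: j_def mod_add_right_eq mod_add_left_eq)
  also have "k mod m + (i - 1 + (m - k mod m)) = i - 1 + m"
    using mod_less_divisor[OF m(1), of k] by linarith
  finally have "(k + j) mod m = i - 1" using m by simp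
  then show ?thesis
    using assms m by (intro exI[of _ j]) (auto simp: cyc_def j_def)
qed

text \<open>Otherwise \<open>a'\<close> would be a multiple of \<open>a\<close>. The condition
  \<open>a \<noteq> a'\<close> keeps the set \<open>{a, a'}\<close> from collapsing to a
  singleton.\<close>

lemma oblique_direction_nonzero:
  fixes a a' :: "'a::real_inner"
  assumes "a \<noteq> a'" "independent {a, a'}"
  shows "a' - (inner a a' / (norm a)\<^sup>2) *\<^sub>R a \<noteq> 0"
proof
  assume "a' - (inner a a' / (norm a)\<^sup>2) *\<^sub>R a = 0"
  then have "a' \<in> span {a}"
    by (metis eq_iff_diff_eq_0 span_base span_scale singletonI)
  then show False
    using assms by (auto simp: insert_commute[of a a'] independent_insert)
qed

theorem theorem2p1:
  fixes A :: "real^'n^'m" and b :: "real^'m" and e :: "nat \<Rightarrow> 'm"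
    and x0 xt :: "real^'n"
  assumes size: "CARD('m) \<ge> CARD('n)"
    and enum: "bij_betw e {1..CARD('m)} UNIV"
    and consistent: "\<exists>x. A *v x = b"
    and nonzero: "\<forall>i\<in>{1..CARD('m)}. row (e i) A \<noteq> 0"
    and indep: "\<forall>i\<in>{1..CARD('m)}.
        let a = row (e i) A; a' = row (e (if i = CARD('m) then 1 else i + 1)) A
        in a \<noteq> a' \<and> independent {a, a'}"
    and solution: "A *v xt = b"
    and proj: "orth_proj (null_space A) xt = orth_proj (null_space A) x0"
  shows "ko_seq A b e x0 \<longlonglongrightarrow> xt \<and>
    (x0 \<in> range ((*v) (transpose A)) \<longrightarrow>
       is_least_norm_solution A b (moore_penrose A *v b) \<and>
       ko_seq A b e x0 \<longlonglongrightarrow> moore_penrose A *v b)"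
proof -
  let ?N = "null_space A"
  define m where "m = CARD('m)"
  have m: "0 < m" by (simp add: m_def)
  \<comment> \<open>Indices are shifted by one: \<open>y 0\<close> is the error after the initial
    plain Kaczmarz step, \<open>a k\<close> is the row just used when the error is
    \<open>y k\<close>, and \<open>w k\<close> leads from \<open>y k\<close> to
    \<open>y (Suc k)\<close>.\<close>
  define a where "a k = row (e (cyc m (Suc k))) A" for k
  define w where "w k = ko_dir A e (Suc k)" for k
  define y where "y k = ko_seq A b e x0 (Suc k) - xt" for k
  define S where "S = {x. \<forall>v\<in>?N. inner x v = 0}"

  have residual: "b $ i - inner (row i A) x = - inner (row i A) (x - xt)" for i x
    by (simp add: inner_diff_right flip: solution matrix_vector_mult_nth)
  have a_nz: "a k \<noteq> 0" for k
    using nonzero cyc_in[OF m] by (simp add: a_def m_def)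
  have w: "w k = a (Suc k) - (inner (a k) (a (Suc k)) / (norm (a k))\<^sup>2) *\<^sub>R a k" for k
    by (simp add: w_def ko_dir_def a_def m_def Let_def)
  have "a k \<noteq> a (Suc k) \<and> independent {a k, a (Suc k)}" for k
    using bspec[OF indep[folded m_def] cyc_in[OF m, of "Suc k"]]
    by (simp add: a_def Let_def cyc_Suc[OF m])
  then have w_nz: "w k \<noteq> 0" for k
    unfolding w by (intro oblique_direction_nonzero) auto

  have a_w: "inner (a k) (w k) = 0" for k
    using a_nz[of k] by (simp add: w inner_diff_right power2_norm_eq_inner)
  have a'_z: "inner (a (Suc k)) z = inner (w k) z" if "inner (a k) z = 0" for k z
    using that by (simp add: w inner_diff_left)

  have y_Suc: "y (Suc k) = y k - (inner (a (Suc k)) (y k) / (norm (w k))\<^sup>2) *\<^sub>R w k" for k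
    by (simp add: y_def residual Let_def w_def a_def m_def)
  have y_0: "y 0 = x0 - xt - (inner (a 0) (x0 - xt) / (norm (a 0))\<^sup>2) *\<^sub>R a 0"
    by (simp add: y_def residual a_def cyc_def)
  have a_y: "inner (a k) (y k) = 0" for k
  proof (induction k)
    case 0
    show ?case
      using a_nz[of 0] unfolding y_0 by (simp add: inner_diff_right power2_norm_eq_inner)
  next
    case (Suc k)
    \<comment> \<open>Moving along \<open>w k\<close> keeps orthogonality to the old row, so
      \<open>a'_z\<close> applies to the new error as well.\<close>
    then have "inner (a k) (y (Suc k)) = 0"
      by (simp add: y_Suc inner_diff_right a_w)
    then have "inner (a (Suc k)) (y (Suc k)) = inner (w k) (y (Suc k))"
      by (rule a'_z)
    also have "\<dots> = 0"
      using w_nz[of k] by (simp add: y_Suc a'_z[OF Suc] inner_diff_right power2_norm_eq_inner)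
    finally show ?case .
  qed
  have "(norm (y (Suc k) - y k))\<^sup>2 = (norm (y k))\<^sup>2 - (norm (y (Suc k)))\<^sup>2" for k
    using norm_projection_step[of "y k" "w k"] by (simp add: y_Suc a'_z[OF a_y])
  then have incr: "(\<lambda>k. y (Suc k) - y k) \<longlonglongrightarrow> 0"
    by (rule increments_tendsto_0)

  have "(\<lambda>k. inner (row i A) (y k)) \<longlonglongrightarrow> 0" for i
  proof (rule inner_tendsto_0_if_recurrently_0[OF incr, of m])
    have "i \<in> e ` {1..m}"
      using bij_betw_imp_surj_on[OF enum] by (simp add: m_def)
    then obtain l where l: "l \<in> {1..m}" "e l = i"
      by blast
    fix k
    obtain j where "j < m" "cyc m (Suc (k + j)) = l"
      using cyc_recurrent[OF l(1)] by blast
    then show "\<exists>j<m. inner (row i A) (y (k + j)) = 0"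
      using a_y[of "k + j"] l(2) by (intro exI[of _ j]) (simp add: a_def)
  qed
  then have lim: "(\<lambda>k. A *v y k) \<longlonglongrightarrow> 0"
    by (intro vec_tendstoI) (simp add: matrix_vector_mult_nth)

  have S: "subspace S"
    by (simp add: S_def subspace_def inner_add_left)
  have a_S: "a k \<in> S" for k
    by (simp add: S_def null_space_def a_def flip: matrix_vector_mult_nth)
  have w_S: "w k \<in> S" for k
    unfolding w by (intro subspace_diff subspace_scale S a_S)
  \<comment> \<open>Equal projections onto the null space cancel in the difference.\<close>
  have "x0 - xt \<in> S"
    using orthogonal_diff_if_orth_proj_eq[OF subspace_null_space proj[symmetric]]
    by (simp add: S_def)
  then have y_S: "y k \<in> S" for k
    by (induction k) (auto simp only: y_0 y_Suc intro!: subspace_diff subspace_scale S a_S w_S)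
  have inj: "x = 0" if "x \<in> S" "A *v x = 0" for x
    using that inner_eq_zero_iff by (auto simp: S_def null_space_def)
  have "y \<longlonglongrightarrow> 0"
    by (rule tendsto_0_if_linear_image[OF matrix_vector_mul_linear S inj y_S lim])
  then have "(\<lambda>k. ko_seq A b e x0 (Suc k)) \<longlonglongrightarrow> xt"
    unfolding y_def by (rule LIM_zero_cancel)
  then have conv: "ko_seq A b e x0 \<longlonglongrightarrow> xt"
    by (rule LIMSEQ_imp_Suc)

  let ?x = "moore_penrose A *v b"
  have x_S: "?x \<in> S"
    using range_transpose_orthogonal_null_space moore_penrose_solution(2)[OF solution]
    by (auto simp: S_def)
  have "is_least_norm_solution A b ?x"
    using x_S by (intro is_least_norm_solutionI moore_penrose_solution(1)[OF solution])
      (simp add: S_def)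
  moreover have "?x = xt" if "x0 \<in> range ((*v) (transpose A))"
  proof -
    have "x0 \<in> S"
      using that range_transpose_orthogonal_null_space by (auto simp: S_def)
    \<comment> \<open>This vector is \<open>xt\<close>. Hence \<open>?x\<close> and
      \<open>xt\<close> are both solutions in \<open>S\<close>, where \<open>A\<close> is
      injective.\<close>
    then have "x0 - (x0 - xt) \<in> S"
      by (rule subspace_diff[OF S _ \<open>x0 - xt \<in> S\<close>])
    then have "?x - xt \<in> S"
      using x_S by (intro subspace_diff S) simp_all
    then have "?x - xt = 0"
      using moore_penrose_solution(1)[OF solution] solution
      by (intro inj) (simp_all add: matrix_vector_mult_diff_distrib)
    then show ?thesis by simp
  qed
  ultimately show ?thesis
    using conv by auto
qed

end
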